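(* Let $k\ge1$ be an integer and let $C_{i,j}:=2\min(i,j)-1$ for $1\le i,j\le k$. Let $(Q_1,\dots,Q_k)$ be the unique solution with all $Q_i\in(0,1)$ of the system $$(1-Q_k)^2=\prod_{1\le j\le k}Q_j^{C_{k,j}},\qquad 1-Q_i=\prod_{1\le j\le k}Q_j^{C_{i,j}}\quad(1\le i\le k-1).$$ Then $$2\bigl(L(1)-L(Q_k)\bigr)+\sum_{i=1}^{k-1}\bigl(L(1)-L(Q_i)\bigr)=\frac{\pi^2}{5}.$$
   Context: $L$ denotes Rogers' dilogarithm function: $L(x):=\mathrm{Li}_2(x)+\frac12\log(x)\log(1-x)$ for $x\in(0,1)$, where $\mathrm{Li}_2(x)=\sum_{n\ge1}\frac{x^n}{n^2}$, extended by $L(0)=0$ and $L(1)=\frac{\pi^2}{6}$. *)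

theory Defs
  imports "HOL-Analysis.Analysis"
begin

(* The index is shifted by one, so that the sum starts with the term x.
   The series converges for \<bar>x\<bar> \<le> 1 only. *)
definition Li2 :: "real \<Rightarrow> real" where
  "Li2 x = (\<Sum>n. x ^ (n + 1) / real (n + 1) ^ 2)"

(* Meaningful for 0 \<le> x \<le> 1. *)
definition rogers_L :: "real \<Rightarrow> real" where
  "rogers_L x =
     (if x = 0 then 0
      else if x = 1 then pi\<^sup>2 / 6
      else Li2 x + 1 / 2 * ln x * ln (1 - x))"

(* Used for i, j \<ge> 1 only, where the natural-number subtraction does not truncate. *)
definition C :: "nat \<Rightarrow> nat \<Rightarrow> nat" where
  "C i j = 2 * min i j - 1"

(* A k-tuple is a function on {1..k}, extensional so that uniqueness of the tuple
   is uniqueness of the function. *)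
definition solves_system :: "nat \<Rightarrow> (nat \<Rightarrow> real) \<Rightarrow> bool" where
  "solves_system k Q \<longleftrightarrow>
     Q \<in> {1..k} \<rightarrow>\<^sub>E {0<..<1} \<and>
     (1 - Q k)\<^sup>2 = (\<Prod>j = 1..k. Q j ^ C k j) \<and>
     (\<forall>i \<in> {1..<k}. 1 - Q i = (\<Prod>j = 1..k. Q j ^ C i j))"

end

theory Submission
  imports Defs "HOL-Real_Asymp.Real_Asymp"
begin

text \<open>
  Put \<open>P i = (\<Prod>j = i..k. Q j)\<close>, and let \<open>R i\<close> be the left-hand side of row \<open>i\<close>. Consecutive rows
  differ by \<open>R (i + 1) = R i * (P (i + 1))\<^sup>2\<close>, and the first row says \<open>R 1 = P 1\<close>. In terms of the
  numbers \<open>D i\<close> with \<open>D k = 1 / (1 - Q k)\<close> and \<open>D (i + 1) = D i + 1\<close>, a downward induction gives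
  \<open>R i = 1 / (D i)\<^sup>2\<close> and \<open>P i = D (i - 1) / D i\<close> for all \<open>i\<close>, and the first row becomes
  \<open>D 0 * D 1 = 1\<close>. Hence \<open>D 0\<close> is the inverse of the golden ratio, and the solution is
  \<open>Q i = 1 - 1 / (D i)\<^sup>2\<close> for \<open>i < k\<close> and \<open>Q k = 1 - 1 / D k\<close>.

  By the reflection formula \<open>L x + L (1 - x) = L 1\<close>, the claim becomes
  \<open>2 * L (1 / D k) + (\<Sum>i = 1..<k. L (1 / (D i)\<^sup>2)) = pi\<^sup>2 / 5\<close>. The duplication formula
  \<open>L (x\<^sup>2) = 2 * L x - 2 * L (x / (1 + x))\<close> at \<open>x = 1 / D i\<close> makes each summand equal to
  \<open>2 * L (1 / D i) - 2 * L (1 / D (i + 1))\<close>, so the left-hand side telescopes to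
  \<open>2 * L (1 / D 1)\<close>. At \<open>x = 1 / D 1\<close> both \<open>1 - x\<close> and \<open>x / (1 + x)\<close> are \<open>x\<^sup>2\<close>, and the
  two formulas together yield \<open>L (1 / D 1) = pi\<^sup>2 / 10\<close>.
\<close>

section \<open>The functional equations of Rogers' dilogarithm\<close>

lemma Li2_summable:
  assumes "\<bar>x\<bar> \<le> 1"
  shows "summable (\<lambda>n. x ^ (n + 1) / real (n + 1) ^ 2)"
proof (rule summable_comparison_test')
  show "summable (\<lambda>n. 1 / real (n + 1) ^ 2)"
    using sums_summable[OF inverse_squares_sums] by (simp add: add_ac)
  show "norm (x ^ (n + 1) / real (n + 1) ^ 2) \<le> 1 / real (n + 1) ^ 2" for n
    using power_le_one[of "\<bar>x\<bar>" "n + 1"] assms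
    by (simp add: power_abs abs_mult divide_right_mono)
qed

lemma Li2_0 [simp]: "Li2 0 = 0"
  by (simp add: Li2_def)

lemma Li2_1: "Li2 1 = pi\<^sup>2 / 6"
  using inverse_squares_sums by (simp add: Li2_def sums_iff add_ac)

lemma continuous_on_Li2: "continuous_on {0..1} Li2"
proof -
  have "uniform_limit {0..1} (\<lambda>n x. \<Sum>i<n. x ^ (i + 1) / real (i + 1) ^ 2)
          (\<lambda>x. \<Sum>i. x ^ (i + 1) / real (i + 1) ^ 2) sequentially"
  proof (rule Weierstrass_m_test)
    show "summable (\<lambda>n. 1 / real (n + 1) ^ 2)"
      using Li2_summable[of 1] by simp
    show "norm (x ^ (n + 1) / real (n + 1) ^ 2) \<le> 1 / real (n + 1) ^ 2"
      if "x \<in> {0..1}" for n and x :: real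
      using power_le_one[of "\<bar>x\<bar>" "n + 1"] that
      by (simp add: power_abs abs_mult divide_right_mono)
  qed
  hence "continuous_on {0..1} (\<lambda>x::real. \<Sum>i. x ^ (i + 1) / real (i + 1) ^ 2)"
    by (rule uniform_limit_theorem[rotated])
       (auto intro!: always_eventually continuous_intros simp del: of_nat_add of_nat_Suc)
  thus ?thesis by (simp add: Li2_def [abs_def])
qed

lemma ln_one_minus_sums:
  assumes "\<bar>x\<bar> < (1 :: real)"
  shows "(\<lambda>n. x ^ (n + 1) / real (n + 1)) sums (- ln (1 - x))"
proof -
  have "ln (1 - x) = (\<Sum>n. (-1) ^ n * (1 / real (n + 1)) * (- x) ^ Suc n)"
    using ln_series[of "1 - x"] assms by simp
  moreover have "(-1) ^ n * (1 / real (n + 1)) * (- x) ^ Suc n = - (x ^ (n + 1) / real (n + 1))" for n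
    using power_mult_distrib[of "-1" "-x" n] by simp
  ultimately have "ln (1 - x) = (\<Sum>n. - (x ^ (n + 1) / real (n + 1)))"
    by presburger
  moreover have "summable (\<lambda>n. x ^ (n + 1) / real (n + 1))"
  proof (rule summable_comparison_test')
    show "summable (\<lambda>n. \<bar>x\<bar> ^ (n + 1))"
      using assms summable_geometric[of "\<bar>x\<bar>"] by (simp add: summable_mult)
    show "norm (x ^ (n + 1) / real (n + 1)) \<le> \<bar>x\<bar> ^ (n + 1)" for n
      using mult_left_mono[of 1 "real n + 1" "\<bar>x\<bar> ^ Suc n"]
      by (simp add: power_abs abs_mult divide_simps add_ac)
  qed
  ultimately show ?thesis
    using summable_sums suminf_minus by fastforce
qed

lemma Li2_has_derivative:
  assumes "0 < x" "x < 1"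
  shows "(Li2 has_real_derivative (- ln (1 - x) / x)) (at x)"
proof -
  define c :: "nat \<Rightarrow> real" where "c n = 1 / real n ^ 2" for n
  have Li2_c: "Li2 y = (\<Sum>n. c n * y ^ n)" if "\<bar>y\<bar> \<le> 1" for y
  proof -
    have "(\<lambda>n. c (Suc n) * y ^ Suc n) sums Li2 y"
      using summable_sums[OF Li2_summable[OF that]] by (simp add: c_def Li2_def)
    hence "(\<lambda>n. c n * y ^ n) sums Li2 y"
      by (subst (asm) sums_Suc_iff) (simp add: c_def)
    thus ?thesis by (simp add: sums_iff)
  qed
  have "summable (\<lambda>n. c n * 1 ^ n)"
    using Li2_summable[of 1] summable_Suc_iff[of "\<lambda>n. 1 / real n ^ 2"] by (simp add: c_def)
  hence "((\<lambda>y. \<Sum>n. c n * y ^ n) has_real_derivative (\<Sum>n. diffs c n * x ^ n)) (at x)"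
    by (rule termdiffs_strong) (use assms in auto)
  moreover have "diffs c n * x ^ n = (x ^ (n + 1) / real (n + 1)) / x" for n
    using assms by (simp add: diffs_def c_def power2_eq_square)
  hence "(\<lambda>n. diffs c n * x ^ n) sums (- ln (1 - x) / x)"
    using sums_divide[OF ln_one_minus_sums[of x], of x] assms by simp
  hence "(\<Sum>n. diffs c n * x ^ n) = - ln (1 - x) / x"
    by (simp add: sums_iff)
  moreover have "eventually (\<lambda>y. y \<in> {0<..<1}) (nhds x)"
    using assms by (intro eventually_nhds_in_open) auto
  hence "eventually (\<lambda>y. Li2 y = (\<Sum>n. c n * y ^ n)) (nhds x)"
    by eventually_elim (rule Li2_c, auto)
  ultimately show ?thesis
    by (simp add: DERIV_cong_ev)
qed

text \<open>Since \<^term>\<open>ln 0 = (0 :: real)\<close>, the generic formula also gives the two end values.\<close>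

lemma rogers_L_eq: "rogers_L x = Li2 x + 1 / 2 * ln x * ln (1 - x)"
  by (simp add: rogers_L_def Li2_1)

lemma rogers_L_0 [simp]: "rogers_L 0 = 0"
  by (simp add: rogers_L_def)

lemma rogers_L_1: "rogers_L 1 = pi\<^sup>2 / 6"
  by (simp add: rogers_L_def)

lemma rogers_L_has_derivative [derivative_intros]:
  assumes "(f has_real_derivative f') (at x)" "0 < f x" "f x < 1"
  shows "((\<lambda>x. rogers_L (f x)) has_real_derivative
           - (ln (1 - f x) / f x + ln (f x) / (1 - f x)) / 2 * f') (at x)"
proof -
  define y where "y = f x"
  have y: "0 < y" "y < 1" using assms by (simp_all add: y_def)
  have "((\<lambda>y. ln y * ln (1 - y)) has_real_derivative (ln (1 - y) / y - ln y / (1 - y))) (at y)"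
    using y by (auto intro!: derivative_eq_intros simp: divide_inverse)
  from DERIV_add[OF Li2_has_derivative[OF y] DERIV_cmult[OF this, of "1 / 2"]]
  have "(rogers_L has_real_derivative
           (- ln (1 - y) / y + 1 / 2 * (ln (1 - y) / y - ln y / (1 - y)))) (at y)"
    by (simp add: rogers_L_eq [abs_def] mult.assoc)
  moreover have "- u / y + 1 / 2 * (u / y - w) = - (u / y + w) / 2" for u w :: real
    by (simp add: field_simps)
  ultimately have "(rogers_L has_real_derivative
           - (ln (1 - f x) / f x + ln (f x) / (1 - f x)) / 2) (at (f x))"
    by (simp only: y_def)
  from DERIV_chain2[OF this assms(1)] show ?thesis .
qed

lemma continuous_on_rogers_L: "continuous_on {0..1} rogers_L"
proof -
  define g :: "real \<Rightarrow> real" where "g x = ln x * ln (1 - x)" for x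
  have "(g \<longlongrightarrow> 0) (at_right 0)" "(g \<longlongrightarrow> 0) (at_left 1)"
    unfolding g_def by real_asymp+
  moreover have "isCont g x" if "0 < x" "x < 1" for x
    unfolding g_def using that by (intro continuous_intros) auto
  ultimately have "continuous_on {0..1} g"
    by (intro continuous_on_IccI) (auto simp: g_def isCont_def)
  hence "continuous_on {0..1} (\<lambda>x. Li2 x + 1 / 2 * g x)"
    by (intro continuous_intros continuous_on_Li2)
  thus ?thesis by (simp add: g_def rogers_L_eq [abs_def] mult.assoc)
qed

text \<open>Both functional equations hold because the difference of the two sides has derivative \<open>0\<close>
  inside the unit interval, is continuous up to the boundary, and vanishes at \<open>0\<close>.\<close>

lemma rogers_L_reflection:
  assumes "0 \<le> x" "x \<le> 1"
  shows "rogers_L x + rogers_L (1 - x) = rogers_L 1"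
proof -
  define f where "f x = rogers_L x + rogers_L (1 - x)" for x
  have "continuous_on {0..1} f"
    unfolding f_def
    by (intro continuous_intros continuous_on_compose2[OF continuous_on_rogers_L]) auto
  moreover have "(f has_real_derivative 0) (at y)" if "0 < y" "y < 1" for y
    unfolding f_def by (rule derivative_eq_intros refl | use that in simp)+
  ultimately have "f x = f 0"
    by (intro DERIV_isconst2[of 0 1]) (use assms in auto)
  thus ?thesis by (simp add: f_def)
qed

lemma rogers_L_duplication:
  assumes "0 \<le> x" "x \<le> 1"
  shows "rogers_L (x\<^sup>2) = 2 * rogers_L x - 2 * rogers_L (x / (1 + x))"
proof -
  define f where "f x = rogers_L (x\<^sup>2) - 2 * rogers_L x + 2 * rogers_L (x / (1 + x))" for x
  have "continuous_on {0..1} f"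
    unfolding f_def
    by (intro continuous_intros continuous_on_compose2[OF continuous_on_rogers_L])
       (auto simp: power_le_one divide_simps)
  moreover have "(f has_real_derivative 0) (at y)" if y: "0 < y" "y < 1" for y
  proof -
    have y2: "y\<^sup>2 < 1" using y by (simp add: power_less_one_iff)
    have ln1: "ln (1 - y\<^sup>2) = ln (1 - y) + ln (1 + y)"
      using y ln_mult_pos[of "1 - y" "1 + y"] by (simp add: power2_eq_square algebra_simps)
    have eq: "1 - y / (1 + y) = 1 / (1 + y)"
      using y by (simp add: field_simps)
    have ln2: "ln (1 - y / (1 + y)) = - ln (1 + y)"
      unfolding eq using y by (simp add: ln_div)
    have ln3: "ln (y / (1 + y)) = ln y - ln (1 + y)"
      using y by (simp add: ln_div)
    have ln4: "ln (y\<^sup>2) = 2 * ln y"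
      using y by (simp add: ln_realpow)
    \<comment> \<open>The derivative of \<open>f\<close> at \<open>y\<close> as a rational expression in \<open>y\<close> and the three independent
      logarithms \<open>a = ln (1 - y)\<close>, \<open>b = ln (1 + y)\<close> and \<open>l = ln y\<close>.\<close>
    have alg: "- ((a + b) / y\<^sup>2 + 2 * l / (1 - y\<^sup>2)) / 2 * (2 * y)
        - 2 * (- (a / y + l / (1 - y)) / 2)
        + 2 * (- (- b / (y / (1 + y)) + (l - b) / (1 / (1 + y))) / 2 * (1 / (1 + y)\<^sup>2)) = 0"
      for a b l :: real
    proof -
      have "1 - y\<^sup>2 = (1 - y) * (1 + y)" by (simp add: power2_eq_square algebra_simps)
      hence l: "2 * l / (1 - y\<^sup>2) * y = l / (1 - y) - l / (1 + y)"
        using y by (simp add: divide_simps) (simp add: algebra_simps)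
      have ab: "(a + b) / y\<^sup>2 * y = a / y + b / y"
        using y by (simp add: power2_eq_square add_divide_distrib distrib_right)
      have half: "- (u + v) / 2 * (2 * y) = - (u * y + v * y)" for u v :: real
        by (simp add: field_simps)
      have b: "2 * (- (- b / (y / (1 + y)) + (l - b) / (1 / (1 + y))) / 2 * (1 / (1 + y)\<^sup>2))
          = b / y - l / (1 + y)"
      proof -
        have "- b / (y / (1 + y)) + (l - b) / (1 / (1 + y)) = (1 + y) * (l - (1 + y) * (b / y))"
          using y by (simp add: field_simps)
        hence "2 * (- (- b / (y / (1 + y)) + (l - b) / (1 / (1 + y))) / 2 * (1 / (1 + y)\<^sup>2))
            = - (((1 + y) * (l - (1 + y) * (b / y))) / (1 + y)\<^sup>2)"
          by simp
        also have "\<dots> = - ((l - (1 + y) * (b / y)) / (1 + y))"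
          using y by (simp add: power2_eq_square)
        also have "\<dots> = b / y - l / (1 + y)"
          using y by (simp add: diff_divide_distrib)
        finally show ?thesis .
      qed
      have cancel: "- (p + q + (r - s)) - 2 * (- (p + r) / 2) + (q - s) = 0" for p q r s :: real
        by (simp add: field_simps)
      show ?thesis
        unfolding half ab l b by (rule cancel)
    qed
    have d: "((\<lambda>y. y / (1 + y)) has_real_derivative 1 / (1 + y)\<^sup>2) (at y)"
      using y by (auto intro!: derivative_eq_intros simp: power2_eq_square)
    have d1: "((\<lambda>y. rogers_L (y\<^sup>2)) has_real_derivative
        - (ln (1 - y\<^sup>2) / y\<^sup>2 + ln (y\<^sup>2) / (1 - y\<^sup>2)) / 2 * (2 * y)) (at y)"
      using y y2 by (intro rogers_L_has_derivative) (auto intro!: derivative_eq_intros)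
    have d2: "(rogers_L has_real_derivative - (ln (1 - y) / y + ln y / (1 - y)) / 2) (at y)"
      using rogers_L_has_derivative[OF DERIV_ident, of y] y by simp
    have d3: "((\<lambda>y. rogers_L (y / (1 + y))) has_real_derivative
        - (ln (1 - y / (1 + y)) / (y / (1 + y))
           + ln (y / (1 + y)) / (1 - y / (1 + y))) / 2 * (1 / (1 + y)\<^sup>2)) (at y)"
      using y by (intro rogers_L_has_derivative d) auto
    have "(f has_real_derivative
        - (ln (1 - y\<^sup>2) / y\<^sup>2 + ln (y\<^sup>2) / (1 - y\<^sup>2)) / 2 * (2 * y)
        - 2 * (- (ln (1 - y) / y + ln y / (1 - y)) / 2)
        + 2 * (- (ln (1 - y / (1 + y)) / (y / (1 + y))
               + ln (y / (1 + y)) / (1 - y / (1 + y))) / 2 * (1 / (1 + y)\<^sup>2))) (at y)"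
      unfolding f_def by (intro DERIV_add DERIV_diff DERIV_cmult d1 d2 d3)
    thus ?thesis
      unfolding ln1 ln2 ln3 ln4 unfolding eq alg .
  qed
  ultimately have "f x = f 0"
    by (intro DERIV_isconst2[of 0 1]) (use assms in auto)
  thus ?thesis by (simp add: f_def)
qed


section \<open>Telescoping along an arithmetic progression\<close>

text \<open>The numbers \<open>i + 1 / \<phi>\<close> for the golden ratio \<open>\<phi> = (1 + sqrt 5) / 2\<close>, the arithmetic
  progression with difference \<open>1\<close> and positive terms whose first two terms have product \<open>1\<close>.\<close>

definition golden_shift :: "nat \<Rightarrow> real" where
  "golden_shift i = real i + (sqrt 5 - 1) / 2"

lemma golden_shift_Suc: "golden_shift (Suc i) = golden_shift i + 1"
  by (simp add: golden_shift_def)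

lemma golden_shift_pos: "golden_shift i > 0"
  by (simp add: golden_shift_def add_nonneg_pos)

lemma golden_shift_gt_1: "i \<ge> 1 \<Longrightarrow> golden_shift i > 1"
  using golden_shift_pos[of "i - 1"] golden_shift_Suc[of "i - 1"] by simp

lemma golden_shift_0_1: "golden_shift 0 * golden_shift 1 = 1"
  by (simp add: golden_shift_def field_simps)

lemma rogers_L_golden: "rogers_L (1 / golden_shift 1) = pi\<^sup>2 / 10"
proof -
  define x where "x = golden_shift 0"
  have x: "0 < x" "x * (1 + x) = 1"
    using golden_shift_pos[of 0] golden_shift_0_1 golden_shift_Suc[of 0]
    by (simp_all add: x_def add.commute)
  have x1: "x < 1"
    using x(2) mult_pos_pos[OF x(1) x(1)] unfolding distrib_left by linarith
  have "1 / (1 + x) = x"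
    using x by (simp add: divide_eq_eq)
  hence "x / (1 + x) = x\<^sup>2" "1 / golden_shift 1 = x"
    using golden_shift_Suc[of 0]
    by (simp_all add: x_def power2_eq_square add.commute divide_inverse)
  moreover have "1 - x = x\<^sup>2"
    using x(2) unfolding distrib_left power2_eq_square by linarith
  ultimately have "3 * rogers_L (x\<^sup>2) = 2 * rogers_L x"
      "rogers_L x + rogers_L (x\<^sup>2) = pi\<^sup>2 / 6"
    using rogers_L_duplication[of x] rogers_L_reflection[of x] x(1) x1 rogers_L_1 by simp_all
  thus ?thesis
    unfolding \<open>1 / golden_shift 1 = x\<close> by linarith
qed

text \<open>With \<open>x = 1 / golden_shift i\<close>, the argument \<open>x / (1 + x)\<close> in the duplication formula is
  \<open>1 / golden_shift (i + 1)\<close>, so that the sum telescopes.\<close>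

lemma rogers_L_sum_golden:
  assumes "k \<ge> 1"
  shows "2 * rogers_L (1 / golden_shift k) + (\<Sum>i = 1..<k. rogers_L (1 / (golden_shift i)\<^sup>2))
           = pi\<^sup>2 / 5"
  using assms
proof (induction k rule: dec_induct)
  case base
  show ?case by (simp add: rogers_L_golden [unfolded One_nat_def])
next
  case (step k)
  have gt: "golden_shift k > 1"
    using step.hyps by (simp add: golden_shift_gt_1)
  have "1 / golden_shift k / (1 + 1 / golden_shift k) = 1 / golden_shift (Suc k)"
    using gt by (simp add: golden_shift_Suc field_simps)
  with rogers_L_duplication[of "1 / golden_shift k"] gt step
  show ?case by (simp add: power_one_over)
qed


section \<open>The solution of the system\<close>

lemma prod_power_C_1:
  "(\<Prod>j = 1..k. Q j ^ C 1 j) = (\<Prod>j = 1..k. Q j :: real)"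
  by (rule prod.cong) (auto simp: C_def)

text \<open>Raising the row index from \<open>i\<close> to \<open>i + 1\<close> raises the exponents \<open>C i j\<close> with \<open>j > i\<close> by \<open>2\<close>
  and leaves the others unchanged.\<close>

lemma prod_power_C_Suc:
  assumes "i \<ge> 1"
  shows "(\<Prod>j = 1..k. Q j ^ C (Suc i) j) = 
           (\<Prod>j = 1..k. Q j ^ C i j) * (\<Prod>j = Suc i..k. Q j :: real)\<^sup>2"
proof -
  have "(\<Prod>j = Suc i..k. Q j)\<^sup>2 = (\<Prod>j = 1..k. if Suc i \<le> j then Q j ^ 2 else 1)"
    unfolding prod_power_distrib
    by (rule prod.mono_neutral_cong_left) (use assms in auto)
  moreover have "C (Suc i) j = C i j + (if Suc i \<le> j then 2 else 0)" if "j \<ge> 1" for j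
    using assms that by (auto simp: C_def min_def)
  hence "(\<Prod>j = 1..k. Q j ^ C (Suc i) j) =
           (\<Prod>j = 1..k. Q j ^ C i j * (if Suc i \<le> j then Q j ^ 2 else 1))"
    by (intro prod.cong) (auto simp: power_add)
  ultimately show ?thesis by (simp add: prod.distrib)
qed

text \<open>The candidate for \<open>Q i\<close> with \<open>i \<le> k\<close> in terms of \<open>D\<close>, which is meant to be an arithmetic
  progression with difference \<open>1\<close> and positive terms. It solves the system if \<open>D 0 * D 1 = 1\<close>.
  The last entry has \<open>D k\<close> in place of its square because the last row has \<open>(1 - Q k)\<^sup>2\<close> on its
  left-hand side.\<close>

definition sol_entry :: "nat \<Rightarrow> (nat \<Rightarrow> real) \<Rightarrow> nat \<Rightarrow> real" where
  "sol_entry k D i = (if i < k then 1 - 1 / (D i)\<^sup>2 else 1 - 1 / D i)"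

lemma one_minus_inverse_square_telescope:
  assumes "d > (0 :: real)"
  shows "(1 - 1 / d\<^sup>2) * (d / (d + 1)) = (d - 1) / d"
proof -
  have "1 - 1 / d\<^sup>2 = (d - 1) * (d + 1) / d\<^sup>2"
    using assms by (simp add: diff_divide_distrib [symmetric] divide_simps)
                   (simp add: power2_eq_square algebra_simps)
  thus ?thesis using assms by (simp add: divide_simps power2_eq_square)
qed

text \<open>All tail products of the candidate collapse to a ratio of two consecutive terms.\<close>

lemma prod_sol_entry:
  assumes "\<And>i. D (Suc i) = D i + 1" "\<And>i. D i > 0" "i \<ge> 1" "i \<le> k"
  shows "(\<Prod>j = i..k. sol_entry k D j) = D (i - 1) / D i"
  using assms(4,3)
proof (induction i rule: inc_induct)
  case base
  have "D k = D (k - 1) + 1" using assms(1)[of "k - 1"] base by simp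
  thus ?case using assms(2)[of k] by (simp add: sol_entry_def field_simps)
next
  case (step i)
  have Di: "D i = D (i - 1) + 1" "D (Suc i) = D i + 1"
    using assms(1)[of "i - 1"] assms(1)[of i] step.prems by simp_all
  have "(\<Prod>j = i..k. sol_entry k D j) = sol_entry k D i * (\<Prod>j = Suc i..k. sol_entry k D j)"
    using step.hyps by (intro prod.atLeast_Suc_atMost) auto
  also have "\<dots> = (1 - 1 / (D i)\<^sup>2) * (D i / D (Suc i))"
    using step by (simp add: sol_entry_def)
  also have "\<dots> = D (i - 1) / D i"
    using one_minus_inverse_square_telescope[OF assms(2)[of i]] Di by simp
  finally show ?case .
qed

lemma solves_system_sol_entry:
  assumes "k \<ge> 1"
  shows "solves_system k (restrict (sol_entry k golden_shift) {1..k})"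
proof -
  let ?D = golden_shift
  let ?Q = "restrict (sol_entry k ?D) {1..k}"
  have tail: "(\<Prod>j = i..k. ?Q j) = ?D (i - 1) / ?D i" if "i \<ge> 1" "i \<le> k" for i
  proof -
    have "(\<Prod>j = i..k. ?Q j) = (\<Prod>j = i..k. sol_entry k ?D j)"
      by (rule prod.cong) (use that in auto)
    thus ?thesis using prod_sol_entry[of ?D] that
      by (simp add: golden_shift_Suc golden_shift_pos)
  qed
  have row: "(\<Prod>j = 1..k. ?Q j ^ C i j) = 1 / (?D i)\<^sup>2" if "i \<ge> 1" "i \<le> k" for i
    using that
  proof (induction i rule: dec_induct)
    case base
    have "?D 0 / ?D 1 = 1 / (?D 1)\<^sup>2"
      using golden_shift_0_1 golden_shift_pos[of 1] by (simp add: field_simps power2_eq_square)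
    thus ?case unfolding prod_power_C_1 using tail[of 1] base by simp
  next
    case (step i)
    have "(\<Prod>j = 1..k. ?Q j ^ C (Suc i) j) = 1 / (?D i)\<^sup>2 * (?D i / ?D (Suc i))\<^sup>2"
      using step tail[of "Suc i"] by (subst prod_power_C_Suc) auto
    thus ?case using golden_shift_pos[of i] by (simp add: field_simps)
  qed
  have "?Q i \<in> {0<..<1}" if "i \<in> {1..k}" for i
    using that golden_shift_gt_1[of i] by (auto simp: sol_entry_def one_less_power)
  hence "?Q \<in> {1..k} \<rightarrow>\<^sub>E {0<..<1}" by auto
  moreover have "(1 - ?Q k)\<^sup>2 = (\<Prod>j = 1..k. ?Q j ^ C k j)"
    using row[of k] assms by (simp add: sol_entry_def power_one_over)
  moreover have "1 - ?Q i = (\<Prod>j = 1..k. ?Q j ^ C i j)" if "i \<in> {1..<k}" for i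
    using row[of i] that by (simp add: sol_entry_def)
  ultimately show ?thesis by (auto simp: solves_system_def)
qed

text \<open>Comparing consecutive rows from the last one upwards determines every \<open>Q i\<close> from \<open>Q k\<close>;
  the first row then fixes \<open>Q k\<close>.\<close>

lemma solves_system_unique:
  assumes "k \<ge> 1" and sol: "solves_system k Q"
  shows "Q = restrict (sol_entry k golden_shift) {1..k}"
proof -
  have Q_ext: "Q \<in> {1..k} \<rightarrow>\<^sub>E {0<..<1}"
    using sol by (simp add: solves_system_def)
  hence Q: "0 < Q i" "Q i < 1" if "1 \<le> i" "i \<le> k" for i
    using that by (auto simp: PiE_def Pi_def)
  \<comment> \<open>The left-hand sides of the system.\<close>
  define R where "R i = (if i < k then 1 - Q i else (1 - Q k)\<^sup>2)" for i
  have R: "R i = (\<Prod>j = 1..k. Q j ^ C i j)" if "1 \<le> i" "i \<le> k" for i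
    using sol that by (cases "i = k") (auto simp: solves_system_def R_def)
  \<comment> \<open>An arithmetic progression in the index, anchored at \<open>D k = 1 / (1 - Q k)\<close>.\<close>
  define D where "D i = 1 / (1 - Q k) - (real k - real i)" for i
  have D_Suc: "D (Suc i) = D i + 1" for i
    by (simp add: D_def)
  have D: "D (i - 1) > 0 \<and> R i = 1 / (D i)\<^sup>2 \<and> (\<Prod>j = i..k. Q j) = D (i - 1) / D i"
    if "1 \<le> i" "i \<le> k" for i
    using that(2,1)
  proof (induction i rule: inc_induct)
    case base
    have "D k = D (k - 1) + 1" "D k = 1 / (1 - Q k)" "0 < Q k" "Q k < 1"
      using D_Suc[of "k - 1"] base Q[of k] by (simp_all add: D_def)
    moreover have "1 / (1 - Q k) - 1 = Q k / (1 - Q k)"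
      using \<open>Q k < 1\<close> by (simp add: diff_divide_eq_iff divide_simps)
    ultimately have "D (k - 1) = Q k / (1 - Q k)"
      by linarith
    with \<open>D k = 1 / (1 - Q k)\<close> \<open>0 < Q k\<close> \<open>Q k < 1\<close> show ?case
      by (simp add: R_def power_one_over)
  next
    case (step i)
    have Di: "D i = D (i - 1) + 1" "D (Suc i) = D i + 1"
      using D_Suc[of "i - 1"] D_Suc[of i] step.prems by simp_all
    have IH: "D i > 0" "R (Suc i) = 1 / (D (Suc i))\<^sup>2" "(\<Prod>j = Suc i..k. Q j) = D i / D (Suc i)"
      using step by simp_all
    have "R (Suc i) = R i * (D i / D (Suc i))\<^sup>2"
      using R[of i] R[of "Suc i"] step prod_power_C_Suc[of i Q k] IH(3) by simp
    hence Ri: "R i = 1 / (D i)\<^sup>2"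
      using IH Di by (simp add: field_simps)
    hence Qi: "Q i = 1 - 1 / (D i)\<^sup>2"
      using step.hyps by (simp add: R_def)
    \<comment> \<open>Positivity of \<open>Q i\<close> is what keeps \<open>D\<close> positive one step further down.\<close>
    have "1 < (D i)\<^sup>2"
      using Q[of i] IH(1) step by (simp add: Qi)
    hence pos: "D (i - 1) > 0"
      using IH(1) Di(1) power_le_one[of "D i" 2] by linarith
    have "(\<Prod>j = i..k. Q j) = Q i * (\<Prod>j = Suc i..k. Q j)"
      using step.hyps by (intro prod.atLeast_Suc_atMost) auto
    also have "\<dots> = (1 - 1 / (D i)\<^sup>2) * (D i / D (Suc i))"
      by (simp add: Qi IH(3))
    also have "\<dots> = D (i - 1) / D i"
      using one_minus_inverse_square_telescope[OF IH(1)] Di by simp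
    finally show ?case using pos Ri by simp
  qed
  have D0: "D 0 > 0" "D 1 = D 0 + 1"
    using D[of 1] assms(1) D_Suc[of 0] by simp_all
  have "1 / (D 1)\<^sup>2 = D 0 / D 1"
    using D[of 1] R[of 1] assms(1) prod_power_C_1[of Q k] by simp
  hence "D 0 * D 1 = 1"
    using D0 by (simp add: divide_simps power2_eq_square)
  hence "D 0 * (D 0 + 1) = 1"
    by (simp only: D0)
  hence "(2 * D 0 + 1)\<^sup>2 = 5"
    unfolding power2_eq_square distrib_left distrib_right by linarith
  hence "2 * D 0 + 1 = sqrt 5"
    using D0 by (intro real_sqrt_unique[symmetric]) auto
  hence "D 0 = golden_shift 0"
    by (simp add: golden_shift_def)
  hence D_eq: "D i = golden_shift i" for i
    by (induction i) (simp_all add: D_Suc golden_shift_Suc)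
  show ?thesis
  proof (rule extensionalityI[of _ "{1..k}"])
    show "Q \<in> extensional {1..k}" using Q_ext by (simp add: PiE_def)
    fix i assume i: "i \<in> {1..k}"
    show "Q i = restrict (sol_entry k golden_shift) {1..k} i"
    proof (cases "i = k")
      case True
      have "D k = 1 / (1 - Q k)" by (simp add: D_def)
      thus ?thesis using True i Q[of k] by (simp add: sol_entry_def D_eq [symmetric])
    next
      case False
      thus ?thesis using i D[of i] by (simp add: sol_entry_def D_eq [symmetric] R_def)
    qed
  qed auto
qed

theorem proposition6p4:
  fixes k :: nat
  assumes "k \<ge> 1"
  shows "(\<exists>!Q. solves_system k Q) \<and>
    (\<forall>Q. solves_system k Q \<longrightarrow>
      2 * (rogers_L 1 - rogers_L (Q k)) + (\<Sum>i = 1..<k. rogers_L 1 - rogers_L (Q i))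
        = pi\<^sup>2 / 5)"
proof (intro conjI allI impI)
  show "\<exists>!Q. solves_system k Q"
    using solves_system_sol_entry[OF assms] solves_system_unique[OF assms] by blast
next
  fix Q assume sol: "solves_system k Q"
  have Q_eq: "Q i = sol_entry k golden_shift i" if "i \<in> {1..k}" for i
    using solves_system_unique[OF assms sol] that by simp
  have refl: "rogers_L 1 - rogers_L (Q i) = rogers_L (1 - Q i)" if "i \<in> {1..k}" for i
  proof -
    have "Q i \<in> {0<..<1}" using sol that by (auto simp: solves_system_def PiE_def Pi_def)
    thus ?thesis using rogers_L_reflection[of "Q i"] by simp
  qed
  have "rogers_L 1 - rogers_L (Q k) = rogers_L (1 / golden_shift k)"
    using refl[of k] Q_eq[of k] assms by (simp add: sol_entry_def)
  moreover have "(\<Sum>i = 1..<k. rogers_L 1 - rogers_L (Q i)) =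
                   (\<Sum>i = 1..<k. rogers_L (1 / (golden_shift i)\<^sup>2))"
  proof (rule sum.cong)
    fix i assume "i \<in> {1..<k}"
    thus "rogers_L 1 - rogers_L (Q i) = rogers_L (1 / (golden_shift i)\<^sup>2)"
      using refl[of i] Q_eq[of i] by (simp add: sol_entry_def)
  qed auto
  ultimately show "2 * (rogers_L 1 - rogers_L (Q k)) +
      (\<Sum>i = 1..<k. rogers_L 1 - rogers_L (Q i)) = pi\<^sup>2 / 5"
    using rogers_L_sum_golden[OF assms] by simp
qed

end
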